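(* Let $X=[0,1]\times[0,1]$ be the unit square equipped with the lexicographic order topology, and let $A=C(X)$ be the $C^{*}$-algebra of continuous complex valued functions on $X$. Then $ZDRR(A)=0$.
   Context: An element $x$ of a $C^{*}$-algebra $A$ is a zero divisor if there is a nonzero $y\in A$ with $xy=0$ or $yx=0$ (so $0$ is a zero divisor in a nonzero algebra). The zero divisor real rank $ZDRR(A)$: for an integer $n\ge 0$, say $ZDRR(A)\le n$ if every $(n+1)$-tuple of self adjoint elements $(a_1,\ldots,a_{n+1})$ of $A$ can be approximated arbitrarily closely in norm by an $(n+1)$-tuple of self adjoint elements $(b_1,\ldots,b_{n+1})$ such that $\sum_{i=1}^{n+1} b_i^{2}$ is not a zero divisor. $ZDRR(A)=n$ if $n$ is the least nonnegative integer with $ZDRR(A)\le n$. *)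

theory Defs
  imports "HOL-Analysis.Analysis"
begin

section \<open>C*-algebras\<close>

class scaleC =
  fixes scaleC :: "complex \<Rightarrow> 'a \<Rightarrow> 'a"  (infixr \<open>*\<^sub>C\<close> 75)

class star =
  fixes star :: "'a \<Rightarrow> 'a"

text \<open>A C*-algebra is not required to have a unit.\<close>

class cstar_algebra = banach + real_normed_algebra + scaleC + star +
  assumes scaleC_of_real: "complex_of_real r *\<^sub>C x = r *\<^sub>R x"
    and scaleC_add_left: "(c + d) *\<^sub>C x = c *\<^sub>C x + d *\<^sub>C x"
    and scaleC_add_right: "c *\<^sub>C (x + y) = c *\<^sub>C x + c *\<^sub>C y"
    and scaleC_scaleC: "c *\<^sub>C (d *\<^sub>C x) = (c * d) *\<^sub>C x"
    and mult_scaleC_left: "(c *\<^sub>C x) * y = c *\<^sub>C (x * y)"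
    and mult_scaleC_right: "x * (c *\<^sub>C y) = c *\<^sub>C (x * y)"
    and norm_scaleC: "norm (c *\<^sub>C x) = cmod c * norm x"
    and star_star: "star (star x) = x"
    and star_add: "star (x + y) = star x + star y"
    and star_scaleC: "star (c *\<^sub>C x) = cnj c *\<^sub>C star x"
    and star_mult: "star (x * y) = star y * star x"
    and norm_star_mult: "norm (star x * x) = (norm x)\<^sup>2"

lemma norm_star: "norm (star x) = norm (x :: 'a :: cstar_algebra)"
proof -
  have le: "norm y \<le> norm (star y)" for y :: 'a
  proof (cases "norm y = 0")
    case False
    have "norm y * norm y \<le> norm (star y) * norm y"
      using norm_star_mult[of y] norm_mult_ineq[of "star y" y] by (simp add: power2_eq_square)
    with False show ?thesis by simp
  qed simp
  show ?thesis
    using le[of x] le[of "star x"] by (simp add: star_star)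
qed

lemma bounded_linear_star: "bounded_linear (star :: 'a :: cstar_algebra \<Rightarrow> 'a)"
proof (rule bounded_linear_intro[where K = 1])
  fix r and x :: 'a
  show "star (r *\<^sub>R x) = r *\<^sub>R star x"
    using star_scaleC[of "complex_of_real r" x] by (simp add: scaleC_of_real)
qed (simp_all add: star_add norm_star)

lemma bounded_linear_scaleC: "bounded_linear ((*\<^sub>C) c :: 'a :: cstar_algebra \<Rightarrow> 'a)"
proof (rule bounded_linear_intro[where K = "cmod c"])
  fix r and x :: 'a
  show "c *\<^sub>C (r *\<^sub>R x) = r *\<^sub>R (c *\<^sub>C x)"
    by (simp add: scaleC_of_real[symmetric] scaleC_scaleC mult.commute)
qed (simp_all add: scaleC_add_right norm_scaleC mult.commute)

definition selfadjoint :: "'a :: cstar_algebra \<Rightarrow> bool"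
  where "selfadjoint x \<longleftrightarrow> star x = x"

definition zero_divisor :: "'a :: cstar_algebra \<Rightarrow> bool"
  where "zero_divisor x \<longleftrightarrow> (\<exists>y. y \<noteq> 0 \<and> (x * y = 0 \<or> y * x = 0))"

section \<open>Zero divisor real rank\<close>

definition ZDRR_le :: "'a :: cstar_algebra itself \<Rightarrow> nat \<Rightarrow> bool"
  where "ZDRR_le (A :: 'a itself) n \<longleftrightarrow>
    (\<forall>a :: nat \<Rightarrow> 'a. (\<forall>i\<in>{1..n+1}. selfadjoint (a i)) \<longrightarrow>
      (\<forall>\<epsilon>>0. \<exists>b :: nat \<Rightarrow> 'a.
        (\<forall>i\<in>{1..n+1}. selfadjoint (b i) \<and> norm (a i - b i) < \<epsilon>) \<and>
        \<not> zero_divisor (\<Sum>i=1..n+1. b i * b i)))"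

text \<open>The infimum of a nonempty set of natural numbers is its least element; the value is
  \<open>\<infinity>\<close> if no bound holds.\<close>

definition ZDRR :: "'a :: cstar_algebra itself \<Rightarrow> enat"
  where "ZDRR A = (INF n \<in> {n. ZDRR_le A n}. enat n)"

lemma ZDRR_eq_iff: "ZDRR A = enat n \<longleftrightarrow> ZDRR_le A n \<and> (\<forall>m<n. \<not> ZDRR_le A m)"
proof -
  have least: "ZDRR A = enat k" if k: "ZDRR_le A k" "\<forall>m<k. \<not> ZDRR_le A m" for k
    unfolding ZDRR_def
  proof (rule antisym)
    show "(INF n \<in> {n. ZDRR_le A n}. enat n) \<le> enat k"
      by (rule INF_lower) (simp add: k)
    show "enat k \<le> (INF n \<in> {n. ZDRR_le A n}. enat n)"
    proof (rule INF_greatest)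
      fix m assume "m \<in> {n. ZDRR_le A n}"
      with k(2) show "enat k \<le> enat m"
        by (cases "m < k") simp_all
    qed
  qed
  show ?thesis
  proof (cases "\<exists>k. ZDRR_le A k")
    case True
    define k where "k = (LEAST k. ZDRR_le A k)"
    have k: "ZDRR_le A k" "\<forall>m<k. \<not> ZDRR_le A m"
      using LeastI_ex[OF True] not_less_Least[of _ "ZDRR_le A"] unfolding k_def by blast+
    have "ZDRR A = enat k" by (rule least[OF k])
    with k least[of n] show ?thesis by auto
  next
    case False
    then have "{n. ZDRR_le A n} = {}" by blast
    then have "ZDRR A = \<infinity>" by (simp add: ZDRR_def top_enat_def)
    with False show ?thesis by simp
  qed
qed

section \<open>The C*-algebra of bounded continuous functions\<close>

instantiation complex :: cstar_algebra
begin

definition scaleC_complex :: "complex \<Rightarrow> complex \<Rightarrow> complex"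
  where "scaleC_complex c z = c * z"

definition star_complex :: "complex \<Rightarrow> complex"
  where "star_complex z = cnj z"

instance
  by standard
    (simp_all add: scaleC_complex_def star_complex_def algebra_simps norm_mult
      power2_eq_square scaleR_conv_of_real)

end

text \<open>The library states this instance only for a metric domain.\<close>

instance bcontfun :: (topological_space, complete_space) complete_space
proof
  fix f :: "nat \<Rightarrow> 'a \<Rightarrow>\<^sub>C 'b"
  assume "Cauchy f"
  then obtain g where "uniform_limit UNIV f g sequentially"
    using uniformly_convergent_eq_cauchy[of "\<lambda>_. True" f]
    unfolding Cauchy_def uniform_limit_sequentially_iff
    by (metis dist_fun_lt_imp_dist_val_lt)
  from uniform_limit_bcontfunE[OF this sequentially_bot]
  obtain l' where "g = apply_bcontfun l'" "f \<longlonglongrightarrow> l'" by metis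
  then show "convergent f"
    by (intro convergentI)
qed

instance bcontfun :: (topological_space, banach) banach ..

lemma bounded_linear_comp_bcontfun:
  assumes "bounded_linear h"
  shows "(\<lambda>x. h (apply_bcontfun f x)) \<in> bcontfun"
proof -
  have "bounded (h ` range (apply_bcontfun f))"
    by (intro bounded_linear_image assms bounded_apply_bcontfun)
  then show ?thesis
    using bounded_linear.continuous_on[OF assms continuous_on_apply_bcontfun, of UNIV f]
    by (simp add: bcontfun_def image_image)
qed

lemma mult_cont_bcontfun:
  fixes f g :: "'a :: topological_space \<Rightarrow>\<^sub>C 'b :: real_normed_algebra"
  shows "(\<lambda>x. f x * g x) \<in> bcontfun"
proof (rule bcontfun_normI)
  show "continuous_on UNIV (\<lambda>x. f x * g x)"
    by (intro continuous_intros continuous_on_apply_bcontfun)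
  show "norm (f x * g x) \<le> norm f * norm g" for x
    by (rule order_trans[OF norm_mult_ineq]) (intro mult_mono norm_bounded; simp)
qed

instantiation bcontfun :: (topological_space, real_normed_algebra) real_normed_algebra
begin

definition times_bcontfun :: "('a \<Rightarrow>\<^sub>C 'b) \<Rightarrow> ('a \<Rightarrow>\<^sub>C 'b) \<Rightarrow> 'a \<Rightarrow>\<^sub>C 'b"
  where "f * g = Bcontfun (\<lambda>x. apply_bcontfun f x * apply_bcontfun g x)"

lemma apply_bcontfun_times [simp]: "apply_bcontfun (f * g) x = f x * g x"
  by (simp add: times_bcontfun_def Bcontfun_inverse mult_cont_bcontfun)

instance
proof
  fix f g :: "'a \<Rightarrow>\<^sub>C 'b"
  show "norm (f * g) \<le> norm f * norm g"
    by (rule norm_bound, simp, rule order_trans[OF norm_mult_ineq])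
      (intro mult_mono norm_bounded; simp)
qed (auto intro!: bcontfun_eqI simp: algebra_simps)

end

instantiation bcontfun :: (topological_space, cstar_algebra) cstar_algebra
begin

definition scaleC_bcontfun :: "complex \<Rightarrow> ('a \<Rightarrow>\<^sub>C 'b) \<Rightarrow> 'a \<Rightarrow>\<^sub>C 'b"
  where "c *\<^sub>C f = Bcontfun (\<lambda>x. c *\<^sub>C apply_bcontfun f x)"

definition star_bcontfun :: "('a \<Rightarrow>\<^sub>C 'b) \<Rightarrow> 'a \<Rightarrow>\<^sub>C 'b"
  where "star f = Bcontfun (\<lambda>x. star (apply_bcontfun f x))"

lemma apply_bcontfun_scaleC [simp]: "apply_bcontfun (c *\<^sub>C f) x = c *\<^sub>C f x"
  by (simp add: scaleC_bcontfun_def Bcontfun_inverse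
      bounded_linear_comp_bcontfun[OF bounded_linear_scaleC])

lemma apply_bcontfun_star [simp]: "apply_bcontfun (star f) x = star (f x)"
  by (simp add: star_bcontfun_def Bcontfun_inverse
      bounded_linear_comp_bcontfun[OF bounded_linear_star])

instance
proof
  fix c :: complex and f :: "'a \<Rightarrow>\<^sub>C 'b"
  have le: "norm (d *\<^sub>C g) \<le> cmod d * norm g" for d and g :: "'a \<Rightarrow>\<^sub>C 'b"
    by (rule norm_bound) (simp add: norm_scaleC mult_left_mono norm_bounded)
  show "norm (c *\<^sub>C f) = cmod c * norm f"
  proof (cases "c = 0")
    case True
    then show ?thesis using le[of c f] by simp
  next
    case False
    have "inverse c *\<^sub>C (c *\<^sub>C f) = f"
      using False scaleC_of_real[of 1] by (auto intro!: bcontfun_eqI simp: scaleC_scaleC)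
    then have "norm f \<le> norm (c *\<^sub>C f) / cmod c"
      using le[of "inverse c" "c *\<^sub>C f"] by (simp add: norm_inverse divide_inverse mult.commute)
    then show ?thesis
      using le[of c f] False by (simp add: field_simps)
  qed
  show "norm (star f * f) = (norm f)\<^sup>2"
  proof (rule antisym)
    have "norm (star f) \<le> norm f"
      by (rule norm_bound) (simp add: norm_star norm_bounded)
    then have "norm (star f) * norm f \<le> norm f * norm f"
      by (rule mult_right_mono) simp
    then show "norm (star f * f) \<le> (norm f)\<^sup>2"
      using norm_mult_ineq[of "star f" f] by (simp add: power2_eq_square)
    have "norm f \<le> sqrt (norm (star f * f))"
    proof (rule norm_bound, rule real_le_rsqrt)
      fix x
      show "(norm (f x))\<^sup>2 \<le> norm (star f * f)"
        using norm_bounded[of "star f * f" x] by (simp add: norm_star_mult)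
    qed
    then show "(norm f)\<^sup>2 \<le> norm (star f * f)"
      using power_mono[of "norm f" "sqrt (norm (star f * f))" 2] by simp
  qed
qed (auto intro!: bcontfun_eqI simp: scaleC_of_real scaleC_add_left scaleC_add_right
    scaleC_scaleC mult_scaleC_left mult_scaleC_right star_star star_add star_scaleC star_mult)

end

section \<open>The lexicographically ordered square\<close>

typedef lex_square = "{0..1::real} \<times> {0..1::real}"
  morphisms lex_coords Lex
  by (rule exI[of _ "(0, 0)"]) simp

instantiation lex_square :: linorder
begin

definition less_eq_lex_square :: "lex_square \<Rightarrow> lex_square \<Rightarrow> bool"
  where "p \<le> q \<longleftrightarrow> fst (lex_coords p) < fst (lex_coords q) \<or>
    fst (lex_coords p) = fst (lex_coords q) \<and> snd (lex_coords p) \<le> snd (lex_coords q)"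

definition less_lex_square :: "lex_square \<Rightarrow> lex_square \<Rightarrow> bool"
  where "p < q \<longleftrightarrow> fst (lex_coords p) < fst (lex_coords q) \<or>
    fst (lex_coords p) = fst (lex_coords q) \<and> snd (lex_coords p) < snd (lex_coords q)"

instance
  by standard
    (auto simp: less_eq_lex_square_def less_lex_square_def prod_eq_iff
      lex_coords_inject[symmetric])

end

text \<open>The topology is the order topology of the ordered set itself; it is not the subspace
  topology of the lexicographically ordered plane.\<close>

instantiation lex_square :: linorder_topology
begin

definition open_lex_square :: "lex_square set \<Rightarrow> bool"
  where "open_lex_square =
    generate_topology (range (\<lambda>a. {..< a}) \<union> range (\<lambda>a. {a <..}))"

instance
  by standard (rule open_lex_square_def)

end

lemma lex_square_lub:
  fixes S :: "lex_square set"
  assumes "S \<noteq> {}"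
  obtains s where "\<And>p. p \<in> S \<Longrightarrow> p \<le> s" "\<And>a. a < s \<Longrightarrow> \<exists>p\<in>S. a < p"
proof -
  have rng: "0 \<le> fst (lex_coords p)" "fst (lex_coords p) \<le> 1"
    "0 \<le> snd (lex_coords p)" "snd (lex_coords p) \<le> 1" for p
    using lex_coords[of p] by auto
  define F where "F = (\<lambda>p. fst (lex_coords p)) ` S"
  define x where "x = Sup F"
  have bddF: "bdd_above F" and neF: "F \<noteq> {}"
    using assms rng by (auto simp: F_def intro!: bdd_aboveI[of _ 1])
  have x01: "0 \<le> x" "x \<le> 1"
  proof -
    obtain p where p: "p \<in> S" using assms by auto
    have "fst (lex_coords p) \<le> x"
      unfolding x_def by (rule cSup_upper[OF _ bddF]) (use p in \<open>simp add: F_def\<close>)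
    then show "0 \<le> x" using rng(1)[of p] by linarith
    show "x \<le> 1"
      unfolding x_def using neF by (rule cSup_least) (auto simp: F_def rng)
  qed
  have upx: "fst (lex_coords p) \<le> x" if "p \<in> S" for p
    using that bddF by (auto simp: x_def F_def intro: cSup_upper)
  have apx: "\<exists>p\<in>S. y < fst (lex_coords p)" if "y < x" for y
    using less_cSupD[OF neF, of y] that by (auto simp: x_def F_def)
  show thesis
  proof (cases "x \<in> F")
    case False
    define s where "s = Lex (x, 0)"
    have s: "lex_coords s = (x, 0)"
      using x01 by (simp add: s_def Lex_inverse)
    show thesis
    proof (rule that[of s])
      fix p assume "p \<in> S"
      then have "fst (lex_coords p) < x"
        using upx[of p] False by (auto simp: F_def less_le)
      then show "p \<le> s" by (simp add: less_eq_lex_square_def s)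
    next
      fix a assume "a < s"
      then have "fst (lex_coords a) < x"
        using rng(3)[of a] by (auto simp: less_lex_square_def s)
      from apx[OF this] show "\<exists>p\<in>S. a < p"
        by (auto simp: less_lex_square_def)
    qed
  next
    case True
    define G where "G = (\<lambda>p. snd (lex_coords p)) ` {p\<in>S. fst (lex_coords p) = x}"
    define y where "y = Sup G"
    have bddG: "bdd_above G" and neG: "G \<noteq> {}"
      using True rng by (auto simp: F_def G_def intro!: bdd_aboveI[of _ 1])
    obtain g where g: "g \<in> G" using neG by auto
    have "0 \<le> g" using g rng by (auto simp: G_def)
    also have "g \<le> y" unfolding y_def by (rule cSup_upper[OF g bddG])
    finally have y0: "0 \<le> y" .
    have y1: "y \<le> 1"
      unfolding y_def using neG by (rule cSup_least) (auto simp: G_def rng)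
    define s where "s = Lex (x, y)"
    have s: "lex_coords s = (x, y)"
      using x01 y0 y1 by (simp add: s_def Lex_inverse)
    show thesis
    proof (rule that[of s])
      fix p assume p: "p \<in> S"
      show "p \<le> s"
      proof (cases "fst (lex_coords p) = x")
        case True
        with p have "snd (lex_coords p) \<le> y"
          unfolding y_def by (intro cSup_upper bddG) (auto simp: G_def)
        with True show ?thesis by (simp add: less_eq_lex_square_def s)
      next
        case False
        with upx[OF p] show ?thesis by (simp add: less_eq_lex_square_def s)
      qed
    next
      fix a assume "a < s"
      then consider "fst (lex_coords a) < x" | "fst (lex_coords a) = x" "snd (lex_coords a) < y"
        by (auto simp: less_lex_square_def s)
      then show "\<exists>p\<in>S. a < p"
      proof cases
        case 1
        from apx[OF this] show ?thesis by (auto simp: less_lex_square_def)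
      next
        case 2
        then obtain z where "z \<in> G" "snd (lex_coords a) < z"
          using less_cSupD[OF neG, of "snd (lex_coords a)"] unfolding y_def by blast
        then obtain p where "p \<in> S" "fst (lex_coords p) = x" "snd (lex_coords a) < snd (lex_coords p)"
          unfolding G_def by blast
        with 2 show ?thesis
          unfolding less_lex_square_def by (intro bexI[of _ p]) simp_all
      qed
    qed
  qed
qed

lemma compact_lex_square: "compact (UNIV :: lex_square set)"
proof (rule compactI)
  fix C :: "lex_square set set"
  assume op: "\<forall>U\<in>C. open U" and cov: "UNIV \<subseteq> \<Union>C"
  define l where "l = Lex (0, 0)"
  define u where "u = Lex (1, 1)"
  have l: "l \<le> p" and u: "p \<le> u" for p
    using lex_coords[of p]
    by (auto simp: l_def u_def less_eq_lex_square_def Lex_inverse)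
  define G where "G = {p. \<exists>D\<subseteq>C. finite D \<and> {..p} \<subseteq> \<Union>D}"
  have ext: "q \<in> G" if pq: "p \<in> G" "U \<in> C" "{..q} \<subseteq> {..p} \<union> U" for p q U
  proof -
    obtain D where "D \<subseteq> C" "finite D" "{..p} \<subseteq> \<Union>D"
      using pq(1) unfolding G_def by blast
    with pq(2,3) show ?thesis
      unfolding G_def by (intro CollectI exI[of _ "insert U D"]) auto
  qed
  have "{..l} = {l}" using l by (auto intro: antisym)
  moreover obtain U0 where "U0 \<in> C" "l \<in> U0" using cov by auto
  ultimately have lG: "l \<in> G"
    unfolding G_def by (intro CollectI exI[of _ "{U0}"]) auto
  then obtain s where ub: "\<And>p. p \<in> G \<Longrightarrow> p \<le> s" and lub: "\<And>a. a < s \<Longrightarrow> \<exists>p\<in>G. a < p"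
    using lex_square_lub[of G] by blast
  obtain U where U: "U \<in> C" "s \<in> U" using cov by auto
  have opU: "open U" using op U by simp
  have sG: "s \<in> G"
  proof (cases "s = l")
    case False
    then have "l < s" using l[of s] by simp
    from open_left[OF opU U(2) this] obtain a where a: "a < s" "{a<..s} \<subseteq> U" by auto
    from lub[OF a(1)] obtain p where p: "p \<in> G" "a < p" by auto
    have "{..s} \<subseteq> {..p} \<union> U"
    proof
      fix z assume "z \<in> {..s}"
      with p(2) have "z \<le> p \<or> z \<in> {a<..s}" by auto
      with a(2) show "z \<in> {..p} \<union> U" by auto
    qed
    from ext[OF p(1) U(1) this] show ?thesis .
  qed (use lG in simp)
  have "s = u"
  proof (rule ccontr)
    assume "s \<noteq> u"
    then have "s < u" using u[of s] by simp
    from open_right[OF opU U(2) this] obtain b where b: "s < b" "{s..<b} \<subseteq> U" by auto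
    show False
    proof (cases "\<exists>c. s < c \<and> c < b")
      case True
      then obtain c where c: "s < c" "c < b" by auto
      have "c \<in> G"
      proof (rule ext[OF sG U(1)], rule subsetI)
        fix z assume "z \<in> {..c}"
        with c have "z \<le> s \<or> z \<in> {s..<b}" by auto
        with b(2) show "z \<in> {..s} \<union> U" by auto
      qed
      from ub[OF this] c(1) show False by simp
    next
      case False
      obtain V where V: "V \<in> C" "b \<in> V" using cov by auto
      have "b \<in> G"
      proof (rule ext[OF sG V(1)], rule subsetI)
        fix z assume "z \<in> {..b}"
        then have "z \<le> b" by simp
        with False have "z \<le> s \<or> z = b" using linorder_le_less_linear[of z s] le_less[of z b] by blast
        with V(2) show "z \<in> {..s} \<union> V" by auto
      qed
      from ub[OF this] b(1) show False by simp
    qed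
  qed
  moreover have "{..u} = UNIV" using u by auto
  ultimately show "\<exists>D\<subseteq>C. finite D \<and> UNIV \<subseteq> \<Union>D"
    using sG unfolding G_def by simp
qed

text \<open>Hence \<open>lex_square \<Rightarrow>\<^sub>C complex\<close> consists of all continuous functions, with the
  supremum norm and the pointwise operations.\<close>

lemma bcontfun_lex_square:
  "(bcontfun :: (lex_square \<Rightarrow> 'b :: metric_space) set) = {f. continuous_on UNIV f}"
  by (auto simp: bcontfun_def intro: compact_imp_bounded compact_continuous_image
      compact_lex_square)

end

theory Submission
  imports Defs
begin

text \<open>
  A continuous real function \<open>f\<close> on the lexicographic square is approximated by a continuous
  function with only finitely many zeros. Any two points \<open>p < q\<close> enclose a nondegenerate segment
  of a vertical fibre, and a function that is constant before and after this segment and affine on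
  it is continuous. Moving from left to right in finitely many such ramps between nonzero values
  close to those of \<open>f\<close> produces at most one zero per ramp. As the square has no isolated points,
  a finite zero set has empty interior, so the square of the approximant is not a zero divisor.
\<close>

section \<open>Order and topology of the lexicographic square\<close>

text \<open>Open rays form a subbase of an order topology, so their preimages decide
  continuity.\<close>

lemma continuous_on_rayI:
  fixes f :: "'a::topological_space \<Rightarrow> 'b::linorder_topology"
  assumes "\<And>a. open {x. a < f x}" "\<And>a. open {x. f x < a}"
  shows "continuous_on UNIV f"
  unfolding continuous_on_def
proof (intro ballI order_tendstoI)
  fix x a
  show "eventually (\<lambda>z. a < f z) (at x)" if "a < f x"
    using assms(1)[of a] that by (auto simp: eventually_at_topological)
  show "eventually (\<lambda>z. f z < a) (at x)" if "f x < a"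
    using assms(2)[of a] that by (auto simp: eventually_at_topological)
qed

lemma lex_coords_bounds:
  "0 \<le> fst (lex_coords p)" "fst (lex_coords p) \<le> 1"
  "0 \<le> snd (lex_coords p)" "snd (lex_coords p) \<le> 1"
  using lex_coords[of p] by auto

lemma Lex_less_Lex_iff:
  assumes "x \<in> {0..1}" "y \<in> {0..1}" "x' \<in> {0..1}" "y' \<in> {0..1}"
  shows "Lex (x, y) < Lex (x', y') \<longleftrightarrow> x < x' \<or> x = x' \<and> y < y'"
  using assms by (simp add: less_lex_square_def Lex_inverse)

text \<open>If \<open>p\<close> and \<open>q\<close> share a fibre, they are themselves the
  endpoints; otherwise the whole fibre over the midpoint of their first coordinates lies between
  them.\<close>

lemma fibre_segment_between:
  fixes p q :: lex_square
  assumes "p < q"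
  obtains x s t where "x \<in> {0..1}" "0 \<le> s" "s < t" "t \<le> 1" "p \<le> Lex (x, s)" "Lex (x, t) \<le> q"
proof (cases "fst (lex_coords p) = fst (lex_coords q)")
  case True
  show thesis
    by (rule that[of "fst (lex_coords p)" "snd (lex_coords p)" "snd (lex_coords q)"])
      (use True assms lex_coords_bounds[of p] lex_coords_bounds[of q] in
        \<open>auto simp: less_lex_square_def less_eq_lex_square_def Lex_inverse lex_coords_inverse\<close>)
next
  case False
  show thesis
    by (rule that[of "(fst (lex_coords p) + fst (lex_coords q)) / 2" 0 1])
      (use False assms lex_coords_bounds[of p] lex_coords_bounds[of q] in
        \<open>auto simp: less_lex_square_def less_eq_lex_square_def Lex_inverse\<close>)
qed

instance lex_square :: dense_linorder
proof
  fix p q :: lex_square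
  assume "p < q"
  then obtain x s t where *: "x \<in> {0..1}" "0 \<le> s" "s < t" "t \<le> 1"
    "p \<le> Lex (x, s)" "Lex (x, t) \<le> q"
    by (rule fibre_segment_between)
  then have "Lex (x, s) < Lex (x, (s + t) / 2)" "Lex (x, (s + t) / 2) < Lex (x, t)"
    by (auto simp: Lex_less_Lex_iff)
  with * show "\<exists>r. p < r \<and> r < q"
    by (meson le_less_trans less_le_trans)
qed

text \<open>Every point has a neighbour on at least one side, and openness yields an order interval
  on that side, which is infinite by density.\<close>

lemma infinite_open_lex_square:
  fixes U :: "lex_square set"
  assumes "open U" "p \<in> U"
  shows "infinite U"
proof -
  have "Lex (0, 0) < Lex (1, 1)" by (simp add: Lex_less_Lex_iff)
  then obtain q where "q < p \<or> p < q"
    by (metis neqE)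
  then show ?thesis
  proof
    assume "q < p"
    from open_left[OF assms this] obtain a where "a < p" "{a<..p} \<subseteq> U" by auto
    then have "infinite {a<..<p}" "{a<..<p} \<subseteq> U" by (auto simp: infinite_Ioo subset_iff)
    then show ?thesis using finite_subset by blast
  next
    assume "p < q"
    from open_right[OF assms this] obtain a where "p < a" "{p..<a} \<subseteq> U" by auto
    then have "infinite {p<..<a}" "{p<..<a} \<subseteq> U" by (auto simp: infinite_Ioo subset_iff)
    then show ?thesis using finite_subset by blast
  qed
qed

section \<open>Continuous ramps along vertical fibres\<close>

text \<open>The ramp is the height along a fibre segment, rescaled and clamped to the unit interval.
  Comparing \<rho> with a level amounts to comparing points in the order, so preimages of rays are
  rays, and an intermediate level is attained only at one point.\<close>

lemma ramp_exists:
  fixes p q :: lex_square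
  assumes "p < q"
  obtains \<rho> :: "lex_square \<Rightarrow> real"
  where "continuous_on UNIV \<rho>" "\<And>z. \<rho> z \<in> {0..1}" "\<And>z. z \<le> p \<Longrightarrow> \<rho> z = 0"
    "\<And>z. q \<le> z \<Longrightarrow> \<rho> z = 1" "\<And>v. v \<in> {0<..<1} \<Longrightarrow> finite (\<rho> -` {v})"
proof -
  obtain x s t where x: "x \<in> {0..1}" and st: "0 \<le> s" "s < t" "t \<le> 1"
    and pq: "p \<le> Lex (x, s)" "Lex (x, t) \<le> q"
    using assms by (rule fibre_segment_between)
  define \<rho> where "\<rho> z = (if fst (lex_coords z) < x then 0 else if x < fst (lex_coords z) then 1
    else max 0 (min 1 ((snd (lex_coords z) - s) / (t - s))))" for z
  have at: "s + a * (t - s) \<in> {0..1}" if "a \<in> {0..1}" for a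
  proof -
    have "0 \<le> a * (t - s)" "a * (t - s) \<le> t - s"
      using that st by (simp_all add: mult_left_le_one_le)
    moreover have "0 \<le> s + d \<and> s + d \<le> 1" if "0 \<le> d" "d \<le> t - s" for d
      using that st by linarith
    ultimately show ?thesis by simp
  qed
  have coords: "lex_coords (Lex (x, s + a * (t - s))) = (x, s + a * (t - s))" if "a \<in> {0..1}" for a
    using at[OF that] x by (simp add: Lex_inverse)
  \<comment> \<open>The level 1 is excluded here because \<rho> never exceeds it although points
    beyond \<open>Lex (x, t)\<close> may exist; the level 0 is excluded from \<open>lt\<close> for
    the symmetric reason.\<close>
  have gt: "a < \<rho> z \<longleftrightarrow> Lex (x, s + a * (t - s)) < z" if a: "a \<in> {0..<1}" for a z
  proof -
    have "a < (snd (lex_coords z) - s) / (t - s) \<longleftrightarrow> s + a * (t - s) < snd (lex_coords z)"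
      using st by (simp add: pos_less_divide_eq less_diff_eq add.commute)
    with a coords[of a] show ?thesis
      by (simp add: \<rho>_def less_lex_square_def less_max_iff_disj)
  qed
  have lt: "\<rho> z < a \<longleftrightarrow> z < Lex (x, s + a * (t - s))" if a: "a \<in> {0<..1}" for a z
  proof -
    have "(snd (lex_coords z) - s) / (t - s) < a \<longleftrightarrow> snd (lex_coords z) < s + a * (t - s)"
      using st by (simp add: pos_divide_less_eq diff_less_eq add.commute)
    with a coords[of a] show ?thesis
      by (simp add: \<rho>_def less_lex_square_def min_less_iff_disj)
  qed
  have range: "\<rho> z \<in> {0..1}" for z
    by (auto simp: \<rho>_def)
  show thesis
  proof (rule that[of \<rho>])
    show "continuous_on UNIV \<rho>"
    proof (rule continuous_on_rayI)
      fix a :: real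
      consider "a < 0" | "a \<in> {0..<1}" | "1 \<le> a" by fastforce
      then show "open {z. a < \<rho> z}"
      proof cases
        case 1
        then have "{z. a < \<rho> z} = UNIV" using range by (auto intro: less_le_trans)
        then show ?thesis by simp
      next
        case 2
        then show ?thesis by (simp add: gt flip: greaterThan_def)
      next
        case 3
        then have "{z. a < \<rho> z} = {}" using range by (auto simp: not_less intro: order_trans)
        then show ?thesis by simp
      qed
      consider "a \<le> 0" | "a \<in> {0<..1}" | "1 < a" by fastforce
      then show "open {z. \<rho> z < a}"
      proof cases
        case 1
        then have "{z. \<rho> z < a} = {}" using range by (auto simp: not_less intro: order_trans)
        then show ?thesis by simp
      next
        case 2
        then show ?thesis by (simp add: lt flip: lessThan_def)
      next
        case 3
        then have "{z. \<rho> z < a} = UNIV" using range by (auto intro: le_less_trans)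
        then show ?thesis by simp
      qed
    qed
    show "\<rho> z = 0" if "z \<le> p" for z
      using gt[of 0 z] range[of z] order_trans[OF that pq(1)] by (auto simp: not_less)
    show "\<rho> z = 1" if "q \<le> z" for z
      using lt[of 1 z] range[of z] order_trans[OF pq(2) that] by (auto simp: not_less)
    show "finite (\<rho> -` {v})" if "v \<in> {0<..<1}" for v
    proof (rule finite_subset)
      show "\<rho> -` {v} \<subseteq> {Lex (x, s + v * (t - s))}"
      proof
        fix z assume "z \<in> \<rho> -` {v}"
        then have "\<not> v < \<rho> z" "\<not> \<rho> z < v" by simp_all
        with gt[of v z] lt[of v z] that show "z \<in> {Lex (x, s + v * (t - s))}"
          using linorder_less_linear[of z "Lex (x, s + v * (t - s))"] by simp
      qed
    qed simp
  qed (rule range)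
qed

section \<open>Approximation with finitely many zeros\<close>

lemma nonzero_real_near:
  fixes r \<delta> :: real
  assumes "\<delta> > 0"
  obtains c where "c \<noteq> 0" "\<bar>c - r\<bar> < \<delta>"
proof (cases "r = 0")
  case True
  with assms show thesis by (intro that[of "\<delta> / 2"]) auto
next
  case False
  with assms show thesis by (intro that[of r]) auto
qed

text \<open>A supremum argument: the points up to which an approximant can be built have a supremum,
  which is itself such a point and cannot lie below the top element.\<close>

lemma approx_finite_zeros:
  fixes f :: "lex_square \<Rightarrow> real"
  assumes f: "continuous_on UNIV f" and \<epsilon>: "\<epsilon> > 0"
  obtains g where "continuous_on UNIV g" "\<And>z. \<bar>g z - f z\<bar> < \<epsilon>" "finite (g -` {0})"
proof -
  define l where "l = Lex (0, 0)"
  define u where "u = Lex (1, 1)"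
  have l: "l \<le> p" and u: "p \<le> u" for p
    using lex_coords[of p]
    by (auto simp: l_def u_def less_eq_lex_square_def Lex_inverse)
  \<comment> \<open>The nonzero constant tail lets a later ramp start at \<open>p\<close> without
    adding zeros beyond it. Its tolerance \<epsilon>/4 and an oscillation below \<epsilon>/2 add up
    to less than \<epsilon>.\<close>
  define good where "good p g c \<longleftrightarrow> continuous_on UNIV g \<and> finite (g -` {0}) \<and> c \<noteq> 0 \<and>
    \<bar>c - f p\<bar> < \<epsilon> / 4 \<and> (\<forall>z\<ge>p. g z = c) \<and> (\<forall>z\<le>p. \<bar>g z - f z\<bar> < \<epsilon>)"
    for p and g :: "lex_square \<Rightarrow> real" and c
  define G where "G = {p. \<exists>g c. good p g c}"
  have ext: "q \<in> G" if p: "p \<in> G" and pq: "p < q"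
    and osc: "\<And>z w. \<lbrakk>z \<in> {p..q}; w \<in> {p..q}\<rbrakk> \<Longrightarrow> \<bar>f z - f w\<bar> < \<epsilon> / 2" for p q
  proof -
    obtain g c where g: "continuous_on UNIV g" "finite (g -` {0})" "c \<noteq> 0"
      "\<bar>c - f p\<bar> < \<epsilon> / 4" "\<And>z. p \<le> z \<Longrightarrow> g z = c" "\<And>z. z \<le> p \<Longrightarrow> \<bar>g z - f z\<bar> < \<epsilon>"
      using p by (auto simp: G_def good_def)
    obtain v where v: "v \<noteq> 0" "\<bar>v - f q\<bar> < \<epsilon> / 4"
      using \<epsilon> by (auto intro: nonzero_real_near[of "\<epsilon> / 4" "f q"])
    obtain \<rho> :: "lex_square \<Rightarrow> real" where \<rho>: "continuous_on UNIV \<rho>" "\<And>z. \<rho> z \<in> {0..1}"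
      "\<And>z. z \<le> p \<Longrightarrow> \<rho> z = 0" "\<And>z. q \<le> z \<Longrightarrow> \<rho> z = 1"
      "\<And>t. t \<in> {0<..<1} \<Longrightarrow> finite (\<rho> -` {t})"
      using ramp_exists[OF pq] by blast
    define h where "h z = g z + (v - c) * \<rho> z" for z
    have "continuous_on UNIV h"
      unfolding h_def by (intro continuous_intros g \<rho>)
    moreover have "finite (h -` {0})"
    proof -
      \<comment> \<open>Past \<open>p\<close> the function is \<open>c + (v - c) * \<rho> z\<close>,
        whose zeros lie on one level set of \<rho>. Levels 0 and 1 cannot occur since
        \<open>c\<close> and \<open>v\<close> are nonzero; if \<open>c = v\<close>, the quotient is
        0 by convention and the empty set is chosen.\<close>
      have "h -` {0} \<subseteq> g -` {0} \<union> (if c / (c - v) \<in> {0<..<1} then \<rho> -` {c / (c - v)} else {})"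
      proof
        fix z assume "z \<in> h -` {0}"
        then have z: "g z + (v - c) * \<rho> z = 0" by (simp add: h_def)
        show "z \<in> g -` {0} \<union> (if c / (c - v) \<in> {0<..<1} then \<rho> -` {c / (c - v)} else {})"
        proof (cases "z \<le> p")
          case True
          with z \<rho>(3) show ?thesis by simp
        next
          case False
          then have eq: "c + (v - c) * \<rho> z = 0" using g(5)[of z] z by simp
          with g(3) have "c \<noteq> v" by auto
          with eq have t: "\<rho> z = c / (c - v)" by (simp add: field_simps)
          have "\<rho> z \<noteq> 0" "\<rho> z \<noteq> 1" using eq g(3) v(1) by auto
          with \<rho>(2)[of z] have "\<rho> z \<in> {0<..<1}" by auto
          with t show ?thesis by auto
        qed
      qed
      moreover have "finite \<dots>" using g(2) \<rho>(5) by simp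
      ultimately show ?thesis by (rule finite_subset)
    qed
    moreover have "h z = v" if "q \<le> z" for z
      using that pq g(5)[of z] \<rho>(4)[of z] by (simp add: h_def)
    moreover have "\<bar>h z - f z\<bar> < \<epsilon>" if "z \<le> q" for z
    proof (cases "z \<le> p")
      case True
      with g(6) \<rho>(3) show ?thesis by (simp add: h_def)
    next
      case False
      then have z: "z \<in> {p..q}" using that by simp
      have h: "h z = (1 - \<rho> z) * c + \<rho> z * v"
        using z g(5)[of z] by (simp add: h_def algebra_simps)
      have "\<bar>f p - f z\<bar> < \<epsilon> / 2" "\<bar>f q - f z\<bar> < \<epsilon> / 2"
        using osc[of p z] osc[of q z] z less_imp_le[OF pq] by simp_all
      \<comment> \<open>Both constants lie within 3\<epsilon>/4 of \<open>f z\<close>, and the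
        interval around \<open>f z\<close> is convex, so it also contains the combination
        \<open>h z\<close>.\<close>
      then have *: "c \<in> {f z - \<epsilon> <..< f z + \<epsilon>}" "v \<in> {f z - \<epsilon> <..< f z + \<epsilon>}"
        using g(4) v(2) \<epsilon>
        unfolding greaterThanLessThan_iff by linarith+
      have "h z \<in> {f z - \<epsilon> <..< f z + \<epsilon>}"
        using convexD[OF convex_real_interval(8) *, of "1 - \<rho> z" "\<rho> z"] \<rho>(2)[of z]
        by (simp add: h)
      then show ?thesis by auto
    qed
    ultimately have "good q h v"
      using v by (auto simp: good_def)
    then show ?thesis by (auto simp: G_def)
  qed
  have "l \<in> G"
  proof -
    obtain c where "c \<noteq> 0" "\<bar>c - f l\<bar> < \<epsilon> / 4"
      using \<epsilon> by (auto intro: nonzero_real_near[of "\<epsilon> / 4" "f l"])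
    \<comment> \<open>At the least element only one value has to be approximated, so a constant
      function starts the construction.\<close>
    moreover have "\<forall>z\<le>l. z = l"
      using l by (simp add: antisym)
    ultimately have "good l (\<lambda>_. c) c"
      unfolding good_def using \<epsilon> by fastforce
    then show ?thesis by (auto simp: G_def)
  qed
  then obtain s where ub: "\<And>p. p \<in> G \<Longrightarrow> p \<le> s" and lub: "\<And>a. a < s \<Longrightarrow> \<exists>p\<in>G. a < p"
    using lex_square_lub[of G] by blast
  define U where "U = f -` {f s - \<epsilon> / 4 <..< f s + \<epsilon> / 4}"
  have U: "open U" "s \<in> U"
    using f \<epsilon> by (auto simp: U_def intro: open_vimage)
  have osc: "\<bar>f z - f w\<bar> < \<epsilon> / 2" if "z \<in> U" "w \<in> U" for z w
    using that unfolding U_def vimage_def mem_Collect_eq greaterThanLessThan_iff abs_less_iff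
    by linarith
  have "s \<in> G"
  proof (cases "s = l")
    case False
    then have "l < s" using l[of s] by simp
    from open_left[OF U this] obtain a where a: "a < s" "{a<..s} \<subseteq> U" by auto
    from lub[OF a(1)] obtain p where p: "p \<in> G" "a < p" by auto
    show ?thesis
    proof (cases "p = s")
      case False
      with ub[OF p(1)] have "p < s" by simp
      moreover have "{p..s} \<subseteq> U" using a(2) p(2) by (auto simp: subset_iff)
      ultimately show ?thesis using ext[OF p(1)] osc by blast
    qed (use p in simp)
  qed (use \<open>l \<in> G\<close> in simp)
  have "s = u"
  proof (rule ccontr)
    assume "s \<noteq> u"
    then have "s < u" using u[of s] by simp
    from open_right[OF U this] obtain b where b: "s < b" "{s..<b} \<subseteq> U" by auto
    \<comment> \<open>Density rules out a jump after \<open>s\<close>, so one more ramp inside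
      \<open>U\<close> passes beyond the supremum.\<close>
    from dense[OF b(1)] obtain c where c: "s < c" "c < b" by auto
    then have "{s..c} \<subseteq> U" using b(2) by (auto simp: subset_iff)
    then have "c \<in> G" using ext[OF \<open>s \<in> G\<close> c(1)] osc by blast
    with ub c(1) show False by (simp add: leD)
  qed
  with \<open>s \<in> G\<close> obtain g c where "good u g c" by (auto simp: G_def)
  then show thesis using u by (intro that[of g]) (auto simp: good_def)
qed

section \<open>Zero divisors and the rank\<close>

text \<open>An annihilating \<open>y\<close> is supported in the zero set of \<open>k\<close>; its
  nonvanishing set would be open, nonempty and finite.\<close>

lemma not_zero_divisor_if_finite_zeros:
  fixes k :: "lex_square \<Rightarrow>\<^sub>C complex"
  assumes "finite {z. k z = 0}"
  shows "\<not> zero_divisor k"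
proof
  assume "zero_divisor k"
  then obtain y where y: "y \<noteq> 0" "k * y = 0 \<or> y * k = 0"
    by (auto simp: zero_divisor_def)
  have "k z * y z = 0" for z
    using y(2) by (metis apply_bcontfun_times mult.commute zero_bcontfun.rep_eq)
  then have "{z. y z \<noteq> 0} \<subseteq> {z. k z = 0}"
    by auto
  then have "finite {z. y z \<noteq> 0}"
    using assms by (rule finite_subset)
  moreover have "open {z. y z \<noteq> 0}"
    by (intro open_Collect_neq continuous_on_apply_bcontfun continuous_intros)
  moreover obtain x where "y x \<noteq> 0"
    using y(1) by (metis bcontfun_eqI zero_bcontfun.rep_eq)
  ultimately show False
    using infinite_open_lex_square by blast
qed

theorem mainTheorem5:
  shows "ZDRR TYPE(lex_square \<Rightarrow>\<^sub>C complex) = 0"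
proof -
  have "ZDRR_le TYPE(lex_square \<Rightarrow>\<^sub>C complex) 0"
    unfolding ZDRR_le_def
  proof (intro allI impI)
    fix a :: "nat \<Rightarrow> lex_square \<Rightarrow>\<^sub>C complex" and \<epsilon> :: real
    assume sa: "\<forall>i\<in>{1..0+1}. selfadjoint (a i)" and \<epsilon>: "\<epsilon> > 0"
    then have "star (a 1) = a 1" by (simp add: selfadjoint_def)
    then have "cnj (a 1 z) = a 1 z" for z
      by (metis apply_bcontfun_star star_complex_def)
    then have re: "a 1 z = complex_of_real (Re (a 1 z))" for z
      by (metis Reals_cnj_iff of_real_Re)
    have "continuous_on UNIV (\<lambda>z. Re (a 1 z))"
      by (intro continuous_intros continuous_on_apply_bcontfun)
    \<comment> \<open>Half of \<epsilon> is used because a pointwise strict bound passes to the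
      supremum norm only as a weak one.\<close>
    then obtain g where g: "continuous_on UNIV g" "\<And>z. \<bar>g z - Re (a 1 z)\<bar> < \<epsilon> / 2"
      "finite (g -` {0})"
      by (rule approx_finite_zeros[of _ "\<epsilon> / 2"]) (use \<epsilon> in auto)
    have "(\<lambda>z. complex_of_real (g z)) \<in> bcontfun"
      \<comment> \<open>Compactness of the square makes boundedness automatic.\<close>
      unfolding bcontfun_lex_square using g(1) by (auto intro: continuous_intros)
    then obtain b :: "lex_square \<Rightarrow>\<^sub>C complex" where b: "\<And>z. b z = complex_of_real (g z)"
      by (metis Bcontfun_inverse)
    have "selfadjoint b"
      by (auto simp: selfadjoint_def b star_complex_def intro!: bcontfun_eqI)
    moreover have "norm (a 1 - b) \<le> \<epsilon> / 2"
    proof (rule norm_bound)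
      fix z
      have "(a 1 - b) z = complex_of_real (Re (a 1 z) - g z)"
        using re[of z] by (simp add: b)
      then show "norm ((a 1 - b) z) \<le> \<epsilon> / 2"
        using g(2)[of z] by (simp add: abs_minus_commute del: of_real_diff)
    qed
    \<comment> \<open>Squaring leaves the zero set unchanged, so it is that of
      \<open>g\<close>.\<close>
    moreover have "\<not> zero_divisor (b * b)"
      using g(3) by (intro not_zero_divisor_if_finite_zeros) (simp add: b vimage_def)
    ultimately show "\<exists>b :: nat \<Rightarrow> lex_square \<Rightarrow>\<^sub>C complex.
        (\<forall>i\<in>{1..0+1}. selfadjoint (b i) \<and> norm (a i - b i) < \<epsilon>) \<and>
        \<not> zero_divisor (\<Sum>i=1..0+1. b i * b i)"
      using \<epsilon> by (intro exI[of _ "\<lambda>_. b"]) simp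
  qed
  then show ?thesis
    by (simp add: ZDRR_eq_iff zero_enat_def)
qed

end
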